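(* Let $R$ be a commutative ring with unity such that $\mathcal{M}^i\neq\mathcal{M}^{i+1}$ for every maximal ideal $\mathcal{M}$ and all $i\geq 0$. Suppose $$\mathcal{I}=\mathcal{M}_1^{t_1}\mathcal{M}_2^{t_2}\cdots\mathcal{M}_k^{t_k}=\mathcal{N}_1^{s_1}\mathcal{N}_2^{s_2}\cdots\mathcal{N}_r^{s_r},$$ where $\mathcal{M}_1,\dots,\mathcal{M}_k$ are pairwise distinct maximal ideals, $\mathcal{N}_1,\dots,\mathcal{N}_r$ are pairwise distinct maximal ideals, and all $t_i,s_j$ are positive integers. Then $r=k$, $\{\mathcal{M}_1,\dots,\mathcal{M}_k\}=\{\mathcal{N}_1,\dots,\mathcal{N}_r\}$, and after a suitable permutation of the $\mathcal{N}_j$ we have $t_i=s_i$ for all $1\le i\le k$. *)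

theory Defs
  imports "HOL-Algebra.Ideal_Product" "HOL-Algebra.FiniteProduct" "HOL-Combinatorics.Permutations"
begin

end

theory Submission
  imports Defs
begin

text \<open>If \<open>P\<close> is maximal and \<open>J\<close> is not contained in \<open>P\<close>, then \<open>P\<close> and \<open>J\<close> are comaximal, so
\<open>P\<^sup>n = P\<^sup>n(P + J) = P\<^sup>n\<^sup>+\<^sup>1 + P\<^sup>nJ\<close>. As \<open>P\<^sup>n\<^sup>+\<^sup>1 \<noteq> P\<^sup>n\<close>, the ideal \<open>P\<^sup>nJ\<close> is not contained in \<open>P\<^sup>n\<^sup>+\<^sup>1\<close>.
Hence the exponent of \<open>P\<close> in a product of powers of distinct maximal ideals is the largest \<open>n\<close>
for which \<open>P\<^sup>n\<close> contains the product, and the factors of positive exponent are the maximal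
ideals containing it.\<close>

lemma carrier_ideals_set [simp]: "J \<in> carrier (ideals_set R) \<longleftrightarrow> ideal J R"
  by (simp add: ideals_set_def)

lemma mult_ideals_set [simp]: "(\<otimes>\<^bsub>ideals_set R\<^esub>) = (\<cdot>\<^bsub>R\<^esub>)"
  by (simp add: ideals_set_def)

lemma one_ideals_set [simp]: "\<one>\<^bsub>ideals_set R\<^esub> = carrier R"
  by (simp add: ideals_set_def)

context cring
begin

interpretation ideals: comm_monoid "ideals_set R"
  by (rule ideals_set_is_comm_monoid)

lemma ideal_pow_is_ideal:
  assumes "ideal J R"
  shows "ideal (J [^]\<^bsub>ideals_set R\<^esub> (n::nat)) R"
  using ideals.nat_pow_closed[of J n] assms by simp

lemma ideal_finprod_is_ideal:
  assumes "\<And>i. i \<in> A \<Longrightarrow> ideal (f i) R"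
  shows "ideal (\<Otimes>\<^bsub>ideals_set R\<^esub>i\<in>A. f i) R"
  using ideals.finprod_closed[of f A] assms by (simp add: Pi_def)

lemma ideal_pow_antimono:
  assumes "ideal J R" "m \<le> n"
  shows "J [^]\<^bsub>ideals_set R\<^esub> (n::nat) \<subseteq> J [^]\<^bsub>ideals_set R\<^esub> (m::nat)"
  using assms(2)
proof (induction n rule: dec_induct)
  case (step n)
  then show ?case
    using ideal_prod_inter[OF ideal_pow_is_ideal[OF assms(1), of n] assms(1)] by auto
qed simp

text \<open>The maximal ideal \<open>P\<close> is prime, so peeling factors off the power leaves
  \<open>Q\<close> inside \<open>P\<close>, and maximality of \<open>Q\<close> makes them equal. For
  exponent 0 the power is the whole ring, which cannot lie in the proper ideal
  \<open>P\<close>.\<close>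

lemma maximalideal_pow_subset_imp_eq:
  assumes P: "maximalideal P R" and Q: "maximalideal Q R"
    and "Q [^]\<^bsub>ideals_set R\<^esub> (n::nat) \<subseteq> P"
  shows "Q = P"
proof -
  interpret P: maximalideal P R by (rule P)
  interpret Q: maximalideal Q R by (rule Q)
  have "Q \<subseteq> P"
    using assms(3)
  proof (induction n)
    case 0
    then show ?case using P.I_notcarr P.a_subset by auto
  next
    case (Suc n)
    then show ?case
      using primeideal_divides_ideal_prod[OF maximalideal_prime[OF P]
          ideal_pow_is_ideal[OF Q.is_ideal] Q.is_ideal] by auto
  qed
  then show ?thesis
    using Q.I_maximal[OF P.is_ideal _ P.a_subset] P.I_notcarr by auto
qed

text \<open>Primality is applied one factor at a time; the empty product is
  \<open>carrier R\<close>, which a proper ideal cannot contain.\<close>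

lemma ideal_finprod_subset_prime:
  assumes P: "primeideal P R" and "finite A" and f: "\<And>i. i \<in> A \<Longrightarrow> ideal (f i) R"
    and sub: "(\<Otimes>\<^bsub>ideals_set R\<^esub>i\<in>A. f i) \<subseteq> P"
  shows "\<exists>i\<in>A. f i \<subseteq> P"
  using assms(2-)
proof (induction A rule: finite_induct)
  case empty
  interpret P: primeideal P R by (rule P)
  show ?case using empty.prems P.I_notcarr P.a_subset by auto
next
  case (insert a A)
  have "f a \<cdot> (\<Otimes>\<^bsub>ideals_set R\<^esub>i\<in>A. f i) \<subseteq> P"
    using insert by (simp add: Pi_def)
  then have "f a \<subseteq> P \<or> (\<Otimes>\<^bsub>ideals_set R\<^esub>i\<in>A. f i) \<subseteq> P"
    using insert.prems(1) ideal_finprod_is_ideal[of A f]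
    by (intro primeideal_divides_ideal_prod[OF P]) auto
  then show ?case using insert by auto
qed

text \<open>As a prime ideal, \<open>P\<close> contains one of the factors, and a maximal ideal with
  a power inside \<open>P\<close> is \<open>P\<close> itself.\<close>

lemma maximalideal_finprod_pow_subset:
  assumes "maximalideal P R" "finite A" "\<And>i. i \<in> A \<Longrightarrow> maximalideal (M i) R"
    and "(\<Otimes>\<^bsub>ideals_set R\<^esub>i\<in>A. M i [^]\<^bsub>ideals_set R\<^esub> (t i :: nat)) \<subseteq> P"
  shows "P \<in> M ` A"
proof -
  obtain i where "i \<in> A" "M i [^]\<^bsub>ideals_set R\<^esub> t i \<subseteq> P"
    using ideal_finprod_subset_prime[OF maximalideal_prime[OF assms(1)] assms(2) _ assms(4)]
      ideal_pow_is_ideal maximalideal.axioms(1)[OF assms(3)] by blast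
  then show ?thesis
    using maximalideal_pow_subset_imp_eq[OF assms(1) assms(3)] by blast
qed

lemma maximalideal_pow_prod_not_subset:
  assumes P: "maximalideal P R" and J: "ideal J R" and "\<not> J \<subseteq> P"
    and ne: "P [^]\<^bsub>ideals_set R\<^esub> (n::nat) \<noteq> P [^]\<^bsub>ideals_set R\<^esub> Suc n"
  shows "\<not> (P [^]\<^bsub>ideals_set R\<^esub> n) \<cdot> J \<subseteq> P [^]\<^bsub>ideals_set R\<^esub> Suc n"
proof
  let ?Q = "P [^]\<^bsub>ideals_set R\<^esub> n" and ?Q' = "P [^]\<^bsub>ideals_set R\<^esub> Suc n"
  assume sub: "?Q \<cdot> J \<subseteq> ?Q'"
  interpret P: maximalideal P R by (rule P)
  have Q: "ideal ?Q R" and Q': "ideal ?Q' R"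
    using ideal_pow_is_ideal[OF P.is_ideal] by blast+
  have sum: "ideal (P <+> J) R"
    by (rule add_ideals[OF P.is_ideal J])
  \<comment> \<open>The sum is the ideal generated by the union, so it contains both
    summands.\<close>
  have "P \<union> J \<subseteq> P <+> J"
    using union_genideal[OF P.is_ideal J] genideal_self[of "P \<union> J"]
      P.a_subset additive_subgroup.a_subset[OF ideal.axioms(1)[OF J]] by auto
  \<comment> \<open>By maximality the sum is \<open>P\<close> or the whole ring; the first would put
    \<open>J\<close> inside \<open>P\<close>.\<close>
  then have "P <+> J = carrier R"
    using P.I_maximal[OF sum] additive_subgroup.a_subset[OF ideal.axioms(1)[OF sum]] assms(3)
    by auto
  \<comment> \<open>Multiply \<open>carrier R = P <+> J\<close> by \<open>?Q\<close> and distribute,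
    using that \<open>?Q \<cdot> P\<close> is \<open>?Q'\<close>.\<close>
  then have "?Q = ?Q' <+> ?Q \<cdot> J"
    using ideal_prod_r_distr[OF Q P.is_ideal J] ideal_prod_one[OF Q] by simp
  also have "\<dots> \<subseteq> ?Q'"
    using sub additive_subgroup.a_closed[OF ideal.axioms(1)[OF Q']]
    by (auto simp: set_add_def')
  finally show False
    using ne ideal_pow_antimono[OF P.is_ideal, of n "Suc n"] by auto
qed

lemma maximalideal_finprod_pow_subset_iff:
  assumes max: "\<And>i. i \<in> A \<Longrightarrow> maximalideal (M i) R"
    and "finite A" "inj_on M A" "a \<in> A"
    and ne: "M a [^]\<^bsub>ideals_set R\<^esub> (t a :: nat) \<noteq> M a [^]\<^bsub>ideals_set R\<^esub> Suc (t a)"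
  shows "(\<Otimes>\<^bsub>ideals_set R\<^esub>i\<in>A. M i [^]\<^bsub>ideals_set R\<^esub> t i) \<subseteq> M a [^]\<^bsub>ideals_set R\<^esub> n \<longleftrightarrow> n \<le> t a"
proof -
  let ?I = "\<Otimes>\<^bsub>ideals_set R\<^esub>i\<in>A. M i [^]\<^bsub>ideals_set R\<^esub> t i"
  let ?J = "\<Otimes>\<^bsub>ideals_set R\<^esub>i\<in>A - {a}. M i [^]\<^bsub>ideals_set R\<^esub> t i"
  have ideal: "ideal (M i [^]\<^bsub>ideals_set R\<^esub> (m::nat)) R" if "i \<in> A" for i m
    using ideal_pow_is_ideal maximalideal.axioms(1)[OF max[OF that]] by blast
  have J: "ideal ?J R"
    by (rule ideal_finprod_is_ideal) (use ideal in auto)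
  \<comment> \<open>Splitting off the factor at \<open>a\<close> brings the product into the form
    \<open>P^n J\<close> with \<open>P = M a\<close> and \<open>n = t a\<close>.\<close>
  have "?I = (\<Otimes>\<^bsub>ideals_set R\<^esub>i\<in>insert a (A - {a}). M i [^]\<^bsub>ideals_set R\<^esub> t i)"
    using assms(4) by (simp add: insert_absorb)
  also have "\<dots> = (M a [^]\<^bsub>ideals_set R\<^esub> t a) \<cdot> ?J"
    using ideal assms(2,4) by (subst ideals.finprod_insert) auto
  finally have I: "?I = (M a [^]\<^bsub>ideals_set R\<^esub> t a) \<cdot> ?J" .
  have "M a \<notin> M ` (A - {a})"
    using assms(3,4) by (auto dest: inj_onD)
  \<comment> \<open>Otherwise \<open>M a\<close> would be one of the remaining maximal ideals,
    against injectivity of \<open>M\<close>.\<close>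
  then have "\<not> ?J \<subseteq> M a"
    using maximalideal_finprod_pow_subset[OF max[OF assms(4)], of "A - {a}" M t] max assms(2)
    by auto
  then have not_sub: "\<not> ?I \<subseteq> M a [^]\<^bsub>ideals_set R\<^esub> Suc (t a)"
    unfolding I by (intro maximalideal_pow_prod_not_subset max assms J)
  have sub: "?I \<subseteq> M a [^]\<^bsub>ideals_set R\<^esub> t a"
    unfolding I using ideal_prod_inter[OF ideal[OF assms(4)] J] by blast
  have anti: "M a [^]\<^bsub>ideals_set R\<^esub> l \<subseteq> M a [^]\<^bsub>ideals_set R\<^esub> m" if "m \<le> l" for l m :: nat
    using ideal_pow_antimono maximalideal.axioms(1)[OF max[OF assms(4)]] that by blast
  \<comment> \<open>Powers decrease, so containment at exponent \<open>t a\<close> and its failure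
    at \<open>Suc (t a)\<close> settle every \<open>n\<close>.\<close>
  show ?thesis
    using sub not_sub anti[of n "t a"] anti[of "Suc (t a)" n] by (meson not_less_eq_eq order_trans)
qed

text \<open>This is one direction of the matching. The two factorisations enter symmetrically, so
  exchanging their roles gives the other direction.\<close>

lemma maximalideal_finprod_pow_unique:
  fixes t :: "'c \<Rightarrow> nat" and s :: "'d \<Rightarrow> nat"
  assumes ne: "\<And>P (n::nat). maximalideal P R \<Longrightarrow>
      P [^]\<^bsub>ideals_set R\<^esub> n \<noteq> P [^]\<^bsub>ideals_set R\<^esub> Suc n"
    and M: "\<And>i. i \<in> A \<Longrightarrow> maximalideal (M i) R" "finite A" "inj_on M A"
    and N: "\<And>j. j \<in> B \<Longrightarrow> maximalideal (N j) R" "finite B" "inj_on N B"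
    and eq: "(\<Otimes>\<^bsub>ideals_set R\<^esub>i\<in>A. M i [^]\<^bsub>ideals_set R\<^esub> t i) =
      (\<Otimes>\<^bsub>ideals_set R\<^esub>j\<in>B. N j [^]\<^bsub>ideals_set R\<^esub> s j)"
    and a: "a \<in> A" "t a > 0"
  shows "\<exists>b\<in>B. N b = M a \<and> s b = t a"
proof -
  have iffM: "(\<Otimes>\<^bsub>ideals_set R\<^esub>i\<in>A. M i [^]\<^bsub>ideals_set R\<^esub> t i) \<subseteq> M a [^]\<^bsub>ideals_set R\<^esub> n
      \<longleftrightarrow> n \<le> t a" for n
    using M a by (intro maximalideal_finprod_pow_subset_iff ne) auto
  \<comment> \<open>Since \<open>t a\<close> is at least 1, the criterion at exponent 1 puts the
    product inside \<open>M a\<close>; then \<open>M a\<close> must occur among the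
    \<open>N j\<close>.\<close>
  have "M a [^]\<^bsub>ideals_set R\<^esub> (1::nat) = M a"
    using M(1) a ideals.l_one[of "M a"] by (simp add: maximalideal.axioms(1))
  then have "(\<Otimes>\<^bsub>ideals_set R\<^esub>i\<in>A. M i [^]\<^bsub>ideals_set R\<^esub> t i) \<subseteq> M a"
    using iffM[of 1] a by simp
  then obtain b where b: "b \<in> B" "N b = M a"
    using maximalideal_finprod_pow_subset[OF M(1)[OF a(1)] N(2,1)] unfolding eq by force
  have "(\<Otimes>\<^bsub>ideals_set R\<^esub>j\<in>B. N j [^]\<^bsub>ideals_set R\<^esub> s j) \<subseteq> N b [^]\<^bsub>ideals_set R\<^esub> n
      \<longleftrightarrow> n \<le> s b" for n
    using N b(1) by (intro maximalideal_finprod_pow_subset_iff ne) auto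
  \<comment> \<open>Both sides say that the n-th power of the same ideal contains the same product.
    Taking \<open>n\<close> to be \<open>s b\<close> and then \<open>t a\<close> yields
    equality.\<close>
  then have "n \<le> s b \<longleftrightarrow> n \<le> t a" for n
    using iffM eq b(2) by metis
  then show ?thesis
    using b by (meson order_antisym order_refl)
qed

end

theorem mainTheorem7:
  fixes R :: "('a, 'b) ring_scheme"
    and I :: "'a set"
    and M N :: "nat \<Rightarrow> 'a set"
    and t s :: "nat \<Rightarrow> nat"
    and k r :: nat
  assumes R: "cring R"
    and powers_distinct:
      "\<And>P (i::nat). maximalideal P R \<Longrightarrow> P [^]\<^bsub>ideals_set R\<^esub> i \<noteq> P [^]\<^bsub>ideals_set R\<^esub> (i + 1)"
    and M_maximal: "\<And>i. i \<in> {1..k} \<Longrightarrow> maximalideal (M i) R"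
    and M_distinct: "inj_on M {1..k}"
    and t_pos: "\<And>i. i \<in> {1..k} \<Longrightarrow> t i > 0"
    and N_maximal: "\<And>j. j \<in> {1..r} \<Longrightarrow> maximalideal (N j) R"
    and N_distinct: "inj_on N {1..r}"
    and s_pos: "\<And>j. j \<in> {1..r} \<Longrightarrow> s j > 0"
    and I_eq_M: "I = (\<Otimes>\<^bsub>ideals_set R\<^esub>i\<in>{1..k}. M i [^]\<^bsub>ideals_set R\<^esub> t i)"
    and I_eq_N: "I = (\<Otimes>\<^bsub>ideals_set R\<^esub>j\<in>{1..r}. N j [^]\<^bsub>ideals_set R\<^esub> s j)"
  shows "r = k \<and> M ` {1..k} = N ` {1..r} \<and>
    (\<exists>\<sigma>. \<sigma> permutes {1..k} \<and> (\<forall>i\<in>{1..k}. N (\<sigma> i) = M i \<and> s (\<sigma> i) = t i))"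
proof -
  interpret cring R by (rule R)
  have ne: "P [^]\<^bsub>ideals_set R\<^esub> (n::nat) \<noteq> P [^]\<^bsub>ideals_set R\<^esub> Suc n"
    if "maximalideal P R" for P and n :: nat
    using powers_distinct[OF that, of n] by simp
  have MN: "\<exists>j\<in>{1..r}. N j = M i \<and> s j = t i" if "i \<in> {1..k}" for i
    using maximalideal_finprod_pow_unique[OF ne M_maximal _ M_distinct N_maximal _ N_distinct
        _ that, of t s] t_pos that I_eq_M I_eq_N by auto
  have NM: "\<exists>i\<in>{1..k}. M i = N j \<and> t i = s j" if "j \<in> {1..r}" for j
    using maximalideal_finprod_pow_unique[OF ne N_maximal _ N_distinct M_maximal _ M_distinct
        _ that, of s t] s_pos that I_eq_M I_eq_N by auto
  have img: "M ` {1..k} = N ` {1..r}"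
    by (intro equalityI image_subsetI) (metis MN imageI, metis NM imageI)
  \<comment> \<open>Both families are injective, so their common image has \<open>k\<close> as well
    as \<open>r\<close> elements.\<close>
  then have "r = k"
    using card_image[OF M_distinct] card_image[OF N_distinct] by simp
  obtain f where f: "f i \<in> {1..r}" "N (f i) = M i" "s (f i) = t i" if "i \<in> {1..k}" for i
    using MN by metis
  \<comment> \<open>The matching \<open>f\<close> is extended by the identity because
    \<open>permutes\<close> demands fixed points outside \<open>{1..k}\<close>.\<close>
  define \<sigma> where "\<sigma> i = (if i \<in> {1..k} then f i else i)" for i
  \<comment> \<open>The value \<open>\<sigma> i\<close> determines
    \<open>N (\<sigma> i) = M i\<close>, hence \<open>i\<close>.\<close>
  have "inj_on \<sigma> {1..k}"
    using f(2) M_distinct by (intro inj_onI) (metis \<sigma>_def inj_onD)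
  moreover have "\<sigma> ` {1..k} \<subseteq> {1..k}"
    using f(1) \<open>r = k\<close> by (auto simp: \<sigma>_def)
  ultimately have "bij_betw \<sigma> {1..k} {1..k}"
    by (simp add: bij_betw_def endo_inj_surj)
  then have "\<sigma> permutes {1..k}"
    by (rule bij_imp_permutes) (auto simp: \<sigma>_def)
  moreover have "\<forall>i\<in>{1..k}. N (\<sigma> i) = M i \<and> s (\<sigma> i) = t i"
    using f by (simp add: \<sigma>_def)
  ultimately show ?thesis
    using \<open>r = k\<close> img by blast
qed

end
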